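(* Let $d \geq 1$ and let $f(n)$ be an SSNN polynomial of degree $d$, and let $\alpha \in \mathbb{C}$ be an arbitrary root of $f(n)$. (a) If $\alpha \in \mathbb{R}$, then $-\frac{d}{2} \leq \alpha \leq \frac{d}{2}-1$; more strictly, $-\lfloor \frac{d}{2} \rfloor \leq \alpha \leq \lfloor \frac{d}{2} \rfloor - 1$. (b) If $d \leq 5$, then $-\frac{d}{2} \leq \Re(\alpha) \leq \frac{d}{2}-1$; more strictly, $-\lfloor \frac{d}{2} \rfloor \leq \Re(\alpha) \leq \lfloor \frac{d}{2} \rfloor - 1$.
   Context: For a sequence of nonnegative real numbers $(\delta_0,\delta_1,\ldots,\delta_d) \in \mathbb{R}_{\geq 0}^{d+1}$, not all zero, which is symmetric, i.e. $\delta_i = \delta_{d-i}$ for $0 \leq i \leq \lfloor d/2 \rfloor$, the polynomial $f(n) = \sum_{i=0}^d \delta_i \binom{n+d-i}{d}$ in $n$ (of degree $d$) is called a symmetric Stanley's nonnegative (SSNN) polynomial of degree $d$. Here $\binom{n+d-i}{d}$ denotes the polynomial $\frac{1}{d!}\prod_{j=0}^{d-1}(n+d-i-j)$ in $n$. $\Re(\alpha)$ denotes the real part of $\alpha$.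
   Formalization: The "more strictly" bounds with ⌊d/2⌋ in (a) and (b) are asserted only for d ≥ 2: for d = 1 they would read 0 ≤ Re(α) ≤ -1, while every SSNN polynomial of degree 1 is c(2n+1) with root -1/2. *)

theory Defs
  imports "HOL-Analysis.Analysis" "HOL-Computational_Algebra.Polynomial"
begin

(* The polynomial (n + c choose d) = (1/d!) * (n + c) (n + c - 1) ... (n + c - d + 1)
   in the indeterminate n. *)
definition shifted_binomial_poly :: "nat \<Rightarrow> real \<Rightarrow> real poly" where
  "shifted_binomial_poly d c =
     smult (1 / fact d) (\<Prod>j<d. [:c - real j, 1:])"

(* Only the values \<delta> 0, ..., \<delta> d matter; no condition is imposed beyond index d. *)
definition symmetric_nonneg_seq :: "nat \<Rightarrow> (nat \<Rightarrow> real) \<Rightarrow> bool" where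
  "symmetric_nonneg_seq d \<delta> \<longleftrightarrow>
     (\<forall>i\<le>d. \<delta> i \<ge> 0) \<and>
     (\<exists>i\<le>d. \<delta> i \<noteq> 0) \<and>
     (\<forall>i\<le>d div 2. \<delta> i = \<delta> (d - i))"

definition SSNN_poly :: "nat \<Rightarrow> real poly \<Rightarrow> bool" where
  "SSNN_poly d f \<longleftrightarrow>
     (\<exists>\<delta>. symmetric_nonneg_seq d \<delta> \<and>
          f = (\<Sum>i\<le>d. smult (\<delta> i) (shifted_binomial_poly d (real d - real i))))"

end

theory Submission
  imports Defs
begin

text \<open>
  Put \<open>P\<^sub>i(x) = (x + d - i) (x + d - i - 1) \<cdots> (x - i + 1)\<close>, so that \<open>d! f = \<Sum> \<delta>\<^sub>i P\<^sub>i\<close>.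
  Since \<open>P\<^sub>i(-1-x) = (-1)\<^sup>d P\<^bsub>d-i\<^esub>(x)\<close>, the roots are symmetric about \<open>-1/2\<close> and only the
  upper bounds matter. For real \<open>x > \<lfloor>d/2\<rfloor> - 1 \<ge> 0\<close> the part of \<open>P\<^sub>i\<close> and \<open>P\<^bsub>d-i\<^esub>\<close> that is not
  common to both can be compared factor by factor, which gives \<open>P\<^sub>i + P\<^bsub>d-i\<^esub> > 0\<close> and hence
  \<open>f(x) > 0\<close>.
  In terms of \<open>y = \<alpha> + 1/2\<close>, symmetry makes \<open>f\<close>, up to a factor \<open>y\<close> for odd \<open>d\<close>, a polynomial
  in \<open>y\<^sup>2\<close>, of degree at most 2 for \<open>d \<le> 5\<close>. If \<open>y\<^sup>2\<close> is real, then \<open>\<alpha>\<close> is real or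
  \<open>Re \<alpha> = -1/2\<close>; otherwise \<open>y\<^sup>2\<close> is one of two conjugate roots, so
  the coefficients determine \<open>Re (y\<^sup>2)\<close> and \<open>\<bar>y\<bar>\<^sup>2\<close>, hence \<open>Re y\<close>.
\<close>

text \<open>This is \<open>P\<^sub>i(x)\<close>, polymorphic so that it can be evaluated at real and
  at complex points alike.\<close>

definition window_prod :: "nat \<Rightarrow> nat \<Rightarrow> 'a::comm_ring_1 \<Rightarrow> 'a" where
  "window_prod d i x = (\<Prod>j<d. x + of_nat d - of_nat i - of_nat j)"

definition weighted_sum :: "nat \<Rightarrow> (nat \<Rightarrow> real) \<Rightarrow> 'a::real_field \<Rightarrow> 'a" where
  "weighted_sum d \<delta> x = (\<Sum>i\<le>d. of_real (\<delta> i) * window_prod d i x)"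

section \<open>Weights and evaluation at a complex point\<close>

lemma symmetric_nonneg_seqD:
  assumes "symmetric_nonneg_seq d \<delta>"
  shows "\<And>i. i \<le> d \<Longrightarrow> \<delta> i \<ge> 0" "\<exists>i\<le>d. \<delta> i > 0" "\<And>i. i \<le> d \<Longrightarrow> \<delta> (d - i) = \<delta> i"
proof -
  show nonneg: "\<delta> i \<ge> 0" if "i \<le> d" for i
    using assms that by (auto simp: symmetric_nonneg_seq_def)
  show "\<exists>i\<le>d. \<delta> i > 0"
    using assms nonneg by (fastforce simp: symmetric_nonneg_seq_def order_less_le)
  show "\<delta> (d - i) = \<delta> i" if "i \<le> d" for i
  proof (cases "i \<le> d div 2")
    case True
    then show ?thesis using assms by (auto simp: symmetric_nonneg_seq_def)
  next
    case False
    then have "d - i \<le> d div 2" by linarith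
    then have "\<delta> (d - i) = \<delta> (d - (d - i))"
      using assms by (auto simp: symmetric_nonneg_seq_def)
    then show ?thesis using that by simp
  qed
qed

text \<open>Each \<open>P\<^sub>i\<close> is monic of degree \<open>d\<close>, so this sum is the
  leading coefficient of \<open>weighted_sum d \<delta>\<close>.\<close>

lemma sum_pos_of_symmetric_nonneg_seq:
  assumes "symmetric_nonneg_seq d \<delta>"
  shows "(\<Sum>i\<le>d. \<delta> i) > 0"
  using symmetric_nonneg_seqD(1,2)[OF assms]
  by (metis atMost_iff finite_atMost sum_pos2)

lemma SSNN_poly_rootE:
  assumes "SSNN_poly d f" "poly (map_poly complex_of_real f) \<alpha> = 0"
  obtains \<delta> where "symmetric_nonneg_seq d \<delta>" "weighted_sum d \<delta> \<alpha> = 0"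
proof -
  obtain \<delta> where \<delta>: "symmetric_nonneg_seq d \<delta>"
    and f: "f = (\<Sum>i\<le>d. smult (\<delta> i) (shifted_binomial_poly d (real d - real i)))"
    using assms(1) by (auto simp: SSNN_poly_def)
  have add: "map_poly complex_of_real (p + q) = map_poly of_real p + map_poly of_real q" for p q
    by (simp add: poly_eq_iff coeff_map_poly)
  have mult: "map_poly complex_of_real (p * q) = map_poly of_real p * map_poly of_real q" for p q
    by (simp add: poly_eq_iff coeff_map_poly coeff_mult)
  have smult: "map_poly complex_of_real (smult c p) = smult (of_real c) (map_poly of_real p)" for c p
    by (simp add: poly_eq_iff coeff_map_poly)
  have eval_sum: "poly (map_poly complex_of_real (sum g A)) \<alpha> =
      (\<Sum>i\<in>A. poly (map_poly of_real (g i)) \<alpha>)" if "finite A" for g and A :: "nat set"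
    using that by induction (auto simp: add)
  have eval_prod: "poly (map_poly complex_of_real (prod g A)) \<alpha> =
      (\<Prod>i\<in>A. poly (map_poly of_real (g i)) \<alpha>)" if "finite A" for g and A :: "nat set"
    using that by induction (auto simp: mult map_poly_1)
  have factor: "poly (map_poly complex_of_real [:c, 1:]) \<alpha> = \<alpha> + of_real c" for c
    by (simp add: map_poly_pCons add.commute)
  have "poly (map_poly complex_of_real f) \<alpha> = weighted_sum d \<delta> \<alpha> / fact d"
    unfolding f weighted_sum_def window_prod_def shifted_binomial_poly_def
    by (simp add: eval_sum eval_prod smult factor sum_divide_distrib algebra_simps)
  then show thesis using that \<delta> assms(2) by auto
qed

section \<open>Reflection in -1/2\<close>

lemma window_prod_reflect:
  assumes "i \<le> d"
  shows "window_prod d i (- 1 - x) = (- 1) ^ d * window_prod d (d - i) x"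
proof -
  \<comment> \<open>Under reflection each factor changes sign and the factors appear in reverse
    order.\<close>
  have "window_prod d i (- 1 - x) = (\<Prod>j<d. - 1 * (x + of_nat d - of_nat (d - i) - of_nat (d - Suc j)))"
    unfolding window_prod_def using assms
    by (intro prod.cong) (auto simp: of_nat_diff Suc_le_eq algebra_simps)
  also have "\<dots> = (\<Prod>j<d. - 1 * (x + of_nat d - of_nat (d - i) - of_nat j))"
    by (rule prod.nat_diff_reindex)
  finally show ?thesis unfolding window_prod_def prod.distrib by simp
qed

lemma sum_atMost_reverse:
  fixes g :: "nat \<Rightarrow> 'a::comm_monoid_add"
  shows "(\<Sum>i\<le>n. g (n - i)) = (\<Sum>i\<le>n. g i)"
  using sum.nat_diff_reindex[of g "Suc n"] by (simp only: lessThan_Suc_atMost diff_Suc_Suc)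

lemma weighted_sum_reflect:
  assumes "symmetric_nonneg_seq d \<delta>"
  shows "weighted_sum d \<delta> (- 1 - x) = (- 1) ^ d * weighted_sum d \<delta> x"
proof -
  have "weighted_sum d \<delta> (- 1 - x) =
      (\<Sum>i\<le>d. (- 1) ^ d * (of_real (\<delta> (d - i)) * window_prod d (d - i) x))"
    unfolding weighted_sum_def
    by (intro sum.cong) (auto simp: window_prod_reflect symmetric_nonneg_seqD(3)[OF assms])
  also have "\<dots> = (\<Sum>i\<le>d. (- 1) ^ d * (of_real (\<delta> i) * window_prod d i x))"
    by (rule sum_atMost_reverse)
  finally show ?thesis by (simp add: weighted_sum_def sum_distrib_left)
qed

section \<open>Positivity on the real axis\<close>

lemma prod_lessThan_add:
  fixes g :: "nat \<Rightarrow> 'a::comm_monoid_mult"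
  shows "(\<Prod>j<m + n. g j) = (\<Prod>j<m. g j) * (\<Prod>j<n. g (m + j))"
  by (induction n) (simp_all add: mult.assoc)

lemma window_prod_pair_pos_aux:
  fixes x :: real
  assumes i: "2 * i \<le> d" and d: "d \<ge> 2" and x: "x > real (d div 2) - 1"
  shows "window_prod d i x + window_prod d (d - i) x > 0"
proof -
  define e where "e = d - 2 * i"
  have de: "d = e + 2 * i" using i by (simp add: e_def)
  have "d div 2 \<ge> 1" "i \<le> d div 2" using d i by auto
  then have x0: "x > 0" and xi: "x > real i - 1" using x by linarith+
  \<comment> \<open>The factors common to both windows; the smallest is \<open>x - i + 1\<close>,
    positive by \<open>xi\<close>.\<close>
  define C where "C = (\<Prod>k<2 * i. x + real i - real k)"
  have "C > 0" unfolding C_def using xi by (intro prod_pos) auto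
  have "window_prod d i x = (\<Prod>j<e. x + real d - real i - real j) * C"
    unfolding window_prod_def C_def de prod_lessThan_add
    by (intro arg_cong2[where f = "(*)"] prod.cong) (auto simp: algebra_simps)
  \<comment> \<open>Reversed, the remaining factors increase with \<open>j\<close> and can be
    matched with those of \<open>high\<close>.\<close>
  also have "(\<Prod>j<e. x + real d - real i - real j) =
      (\<Prod>j<e. x + real d - real i - real (e - Suc j))"
    by (rule prod.nat_diff_reindex[symmetric])
  also have "\<dots> = (\<Prod>j<e. x + real i + 1 + real j)"
    by (intro prod.cong) (auto simp: de of_nat_diff Suc_le_eq)
  finally have low: "window_prod d i x = (\<Prod>j<e. x + real i + 1 + real j) * C" .
  have "window_prod d (d - i) x = (\<Prod>j<2 * i + e. x + real i - real j)"
    unfolding window_prod_def using i by (intro prod.cong) (auto simp: de of_nat_diff)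
  then have high: "window_prod d (d - i) x = (\<Prod>j<e. x - real i - real j) * C"
    unfolding C_def prod_lessThan_add by (simp add: algebra_simps)
  have "(\<Prod>j<e. x + real i + 1 + real j) + (\<Prod>j<e. x - real i - real j) > 0"
  proof (cases "e = 0")
    case False
    \<comment> \<open>Factorwise, \<open>\<bar>x - i - j\<bar> < x + i + 1 + j\<close> because
      \<open>x > 0\<close>.\<close>
    have "\<bar>\<Prod>j<e. x - real i - real j\<bar> < (\<Prod>j<e. x + real i + 1 + real j)"
      unfolding abs_prod using x0 False by (intro prod_mono_strict) auto
    then show ?thesis by linarith
  qed simp
  then show ?thesis using \<open>C > 0\<close> unfolding low high
    by (simp flip: distrib_right)
qed

lemma window_prod_pair_pos:
  fixes x :: real
  assumes "i \<le> d" "d \<ge> 2" "x > real (d div 2) - 1"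
  shows "window_prod d i x + window_prod d (d - i) x > 0"
proof (cases "2 * i \<le> d")
  case True
  then show ?thesis using window_prod_pair_pos_aux assms by blast
next
  case False
  then show ?thesis
    using window_prod_pair_pos_aux[of "d - i" d x] assms by (simp add: add.commute)
qed

lemma weighted_sum_pos:
  fixes x :: real
  assumes \<delta>: "symmetric_nonneg_seq d \<delta>" and x: "d \<ge> 2" "x > real (d div 2) - 1"
  shows "weighted_sum d \<delta> x > 0"
proof -
  have "weighted_sum d \<delta> x = (\<Sum>i\<le>d. \<delta> (d - i) * window_prod d (d - i) x)"
    unfolding weighted_sum_def of_real_eq_id id_apply by (rule sum_atMost_reverse[symmetric])
  also have "\<dots> = (\<Sum>i\<le>d. \<delta> i * window_prod d (d - i) x)"
    by (intro sum.cong) (auto simp: symmetric_nonneg_seqD(3)[OF \<delta>])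
  finally have "2 * weighted_sum d \<delta> x =
      (\<Sum>i\<le>d. \<delta> i * (window_prod d i x + window_prod d (d - i) x))"
    by (simp add: weighted_sum_def distrib_left sum.distrib)
  also have "\<dots> > 0"
  proof -
    obtain k where k: "k \<le> d" "\<delta> k > 0" using symmetric_nonneg_seqD(2)[OF \<delta>] by blast
    have "0 \<le> \<delta> i * (window_prod d i x + window_prod d (d - i) x)" if "i \<le> d" for i
      using symmetric_nonneg_seqD(1)[OF \<delta> that] window_prod_pair_pos[OF that x] by simp
    moreover have "0 < \<delta> k * (window_prod d k x + window_prod d (d - k) x)"
      using k window_prod_pair_pos[OF k(1) x] by simp
    ultimately show ?thesis using k(1) by (intro sum_pos2[of _ k]) auto
  qed
  finally show ?thesis by simp
qed

lemma weighted_sum_of_real: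
  "weighted_sum d \<delta> (of_real x :: 'a::real_field) = of_real (weighted_sum d \<delta> x)"
  by (simp add: weighted_sum_def window_prod_def)

lemma Re_le_of_real_root:
  assumes "symmetric_nonneg_seq d \<delta>" "d \<ge> 2" "weighted_sum d \<delta> \<alpha> = 0" "\<alpha> \<in> \<real>"
  shows "Re \<alpha> \<le> real (d div 2) - 1"
proof -
  have "weighted_sum d \<delta> (Re \<alpha>) = 0"
    using assms(3,4) by (metis of_real_0 of_real_Re of_real_eq_iff weighted_sum_of_real)
  then show ?thesis using weighted_sum_pos[OF assms(1,2), of "Re \<alpha>"] by fastforce
qed

section \<open>Nonreal roots in degree at most 5\<close>

lemma real_or_imaginary_of_square_linear:
  assumes "a \<noteq> 0" "of_real a * y\<^sup>2 + of_real b = (0::complex)"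
  shows "Im y = 0 \<or> Re y = 0"
  \<comment> \<open>The imaginary part of the equation is
    \<open>2 * a * Re y * Im y = 0\<close>.\<close>
  using arg_cong[OF assms(2), of Im] assms(1) by (auto simp: power2_eq_square)

text \<open>
  For nonreal \<open>y\<^sup>2\<close>, \<open>Re y \<le> 3/2\<close> amounts to \<open>4ac \<le> (9a + b)\<^sup>2\<close>. The hypothesis on \<open>c\<close> replaces
  the right-hand side by its tangent at \<open>b = -5a/2\<close>; being linear in \<open>a, b, c\<close>, it only has to be
  checked for each \<open>\<delta>\<^sub>i\<close> separately.
\<close>

lemma Re_le_of_square_quadratic:
  assumes a: "a > 0" and root: "of_real a * y ^ 4 + of_real b * y\<^sup>2 + of_real c = (0::complex)"
    and c: "4 * c \<le> 299 / 4 * a + 13 * b"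
  shows "Im y = 0 \<or> Re y \<le> 3 / 2"
proof (rule ccontr)
  assume "\<not> ?thesis"
  then have y: "Im y \<noteq> 0" "Re y > 3 / 2" by auto
  define v where "v = (Re y)\<^sup>2 - (Im y)\<^sup>2"
  define w where "w = 2 * Re y * Im y"
  define r where "r = (Re y)\<^sup>2 + (Im y)\<^sup>2"
  have y2: "y\<^sup>2 = Complex v w"
    by (simp add: complex_eq_iff v_def w_def power2_eq_square)
  have y4: "y ^ 4 = Complex (v\<^sup>2 - w\<^sup>2) (2 * v * w)"
    using power_mult[of y 2 2] unfolding y2 by (simp add: complex_eq_iff power2_eq_square)
  have "w \<noteq> 0" using y by (simp add: w_def)
  have "w * (2 * a * v + b) = 0"
    using arg_cong[OF root, of Im] by (simp add: y2 y4 algebra_simps)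
  then have b: "b = - 2 * a * v" using \<open>w \<noteq> 0\<close> by simp
  have "a * (v\<^sup>2 - w\<^sup>2) + b * v + c = 0"
    using arg_cong[OF root, of Re] by (simp add: y2 y4)
  then have "c = a * (v\<^sup>2 + w\<^sup>2)"
    unfolding b by (simp add: algebra_simps power2_eq_square)
  also have "v\<^sup>2 + w\<^sup>2 = r\<^sup>2"
    unfolding v_def w_def r_def by algebra
  finally have "a * (4 * r\<^sup>2) \<le> a * (299 / 4 - 26 * v)"
    using c unfolding b by (simp add: algebra_simps)
  then have "4 * r\<^sup>2 \<le> 299 / 4 - 26 * v" using a by simp
  \<comment> \<open>Both terms on the right vanish exactly at \<open>Re y = 3/2\<close>,
    \<open>Im y = 1\<close> or \<open>-1\<close>, where \<open>v = 5/4\<close>: the point of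
    tangency.\<close>
  moreover have "4 * r\<^sup>2 - (299 / 4 - 26 * v) = 4 * (r - 13 / 4)\<^sup>2 + 52 * ((Re y)\<^sup>2 - 9 / 4)"
    unfolding v_def r_def by algebra
  moreover have "52 * ((Re y)\<^sup>2 - 9 / 4) > 0"
    using power_strict_mono[OF y(2), of 2] by (simp add: power2_eq_square)
  moreover have "4 * (r - 13 / 4)\<^sup>2 \<ge> 0" by simp
  ultimately show False by linarith
qed

text \<open>For \<open>d\<close> = 2, 3 a nonreal root has \<open>Re y = 0\<close>. For
  \<open>d\<close> = 4, 5 the bound is \<open>Re \<alpha> \<le> 1\<close>, that is
  \<open>Re y \<le> 3/2\<close>.\<close>

lemma Re_le_of_small_degree:
  assumes \<delta>: "symmetric_nonneg_seq d \<delta>" and d: "2 \<le> d" "d \<le> 5" and root: "weighted_sum d \<delta> \<alpha> = 0"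
  shows "Re \<alpha> \<le> real (d div 2) - 1"
proof (cases "\<alpha> \<in> \<real>")
  case True
  then show ?thesis using Re_le_of_real_root \<delta> d(1) root by blast
next
  case False
  define y where "y = \<alpha> + 1 / 2"
  have \<alpha>: "\<alpha> = y - 1 / 2" by (simp add: y_def)
  have Im: "Im y \<noteq> 0" using False by (simp add: y_def complex_is_Real_iff)
  then have "y \<noteq> 0" by auto
  have Re: "Re \<alpha> = Re y - 1 / 2" by (simp add: y_def)
  note expand = weighted_sum_def window_prod_def \<alpha> eval_nat_numeral
  have nonneg: "\<And>i. i \<le> d \<Longrightarrow> \<delta> i \<ge> 0" and sym: "\<And>i. i \<le> d \<Longrightarrow> \<delta> (d - i) = \<delta> i"
    using symmetric_nonneg_seqD(1,3)[OF \<delta>] by auto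
  have pos: "(\<Sum>i\<le>d. \<delta> i) > 0" using sum_pos_of_symmetric_nonneg_seq[OF \<delta>] .
  consider "d = 2" | "d = 3" | "d = 4" | "d = 5" using d by linarith
  then show ?thesis
  proof cases
    case 1
    have s: "\<delta> (Suc (Suc 0)) = \<delta> 0" using sym[of 0] 1 by (simp add: eval_nat_numeral)
    have "(\<Sum>i\<le>d. \<delta> i) = 2 * \<delta> 0 + \<delta> 1" by (simp add: 1 eval_nat_numeral s)
    moreover have "weighted_sum d \<delta> \<alpha> =
        of_real (2 * \<delta> 0 + \<delta> 1) * y\<^sup>2 + of_real (3 / 2 * \<delta> 0 - \<delta> 1 / 4)"
      by (simp add: expand 1 s) (simp add: field_simps)
    ultimately have "Re y = 0"
      using real_or_imaginary_of_square_linear Im pos root by (metis less_irrefl)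
    then show ?thesis using 1 Re by simp
  next
    case 2
    have s: "\<delta> (Suc (Suc (Suc 0))) = \<delta> 0" "\<delta> (Suc (Suc 0)) = \<delta> (Suc 0)" using sym[of 0] sym[of 1] 2 by (simp_all add: eval_nat_numeral)
    have "(\<Sum>i\<le>d. \<delta> i) = 2 * \<delta> 0 + 2 * \<delta> 1" by (simp add: 2 eval_nat_numeral s)
    moreover have "weighted_sum d \<delta> \<alpha> =
        y * (of_real (2 * \<delta> 0 + 2 * \<delta> 1) * y\<^sup>2 + of_real (23 / 2 * \<delta> 0 - \<delta> 1 / 2))"
      by (simp add: expand 2 s) (simp add: field_simps)
    ultimately have "Re y = 0"
      using real_or_imaginary_of_square_linear Im pos root \<open>y \<noteq> 0\<close>
      by (metis less_irrefl mult_eq_0_iff)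
    then show ?thesis using 2 Re by simp
  next
    case 3
    have s: "\<delta> (Suc (Suc (Suc (Suc 0)))) = \<delta> 0" "\<delta> (Suc (Suc (Suc 0))) = \<delta> (Suc 0)" using sym[of 0] sym[of 1] 3 by (simp_all add: eval_nat_numeral)
    define a where "a = 2 * \<delta> 0 + 2 * \<delta> 1 + \<delta> 2"
    \<comment> \<open>The \<open>\<delta> 2\<close> terms alone give \<open>b = -5a/2\<close>, the
      point of tangency; the same holds for \<open>d = 5\<close>.\<close>
    define b where "b = 43 * \<delta> 0 + 7 * \<delta> 1 - 5 / 2 * \<delta> 2"
    define c where "c = 105 / 8 * \<delta> 0 - 15 / 8 * \<delta> 1 + 9 / 16 * \<delta> 2"
    have "a > 0" using pos by (simp add: a_def 3 eval_nat_numeral s)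
    moreover have "weighted_sum d \<delta> \<alpha> = of_real a * y ^ 4 + of_real b * y\<^sup>2 + of_real c"
      by (simp add: expand 3 s a_def b_def c_def) (simp add: field_simps)
    moreover have "4 * c \<le> 299 / 4 * a + 13 * b"
      unfolding a_def b_def c_def
      using nonneg[of 0] nonneg[of 1] nonneg[of 2] 3 by (simp add: field_simps)
    ultimately have "Re y \<le> 3 / 2" using Re_le_of_square_quadratic Im root by metis
    then show ?thesis using 3 Re by simp
  next
    case 4
    have s: "\<delta> (Suc (Suc (Suc (Suc (Suc 0))))) = \<delta> 0" "\<delta> (Suc (Suc (Suc (Suc 0)))) = \<delta> (Suc 0)" "\<delta> (Suc (Suc (Suc 0))) = \<delta> (Suc (Suc 0))"
      using sym[of 0] sym[of 1] sym[of 2] 4 by (simp_all add: eval_nat_numeral)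
    define a where "a = 2 * \<delta> 0 + 2 * \<delta> 1 + 2 * \<delta> 2"
    define b where "b = 115 * \<delta> 0 + 35 * \<delta> 1 - 5 * \<delta> 2"
    define c where "c = 1689 / 8 * \<delta> 0 - 71 / 8 * \<delta> 1 + 9 / 8 * \<delta> 2"
    have "a > 0" using pos by (simp add: a_def 4 eval_nat_numeral s)
    moreover have "weighted_sum d \<delta> \<alpha> = y * (of_real a * y ^ 4 + of_real b * y\<^sup>2 + of_real c)"
      by (simp add: expand 4 s a_def b_def c_def) (simp add: field_simps)
    moreover have "4 * c \<le> 299 / 4 * a + 13 * b"
      unfolding a_def b_def c_def
      using nonneg[of 0] nonneg[of 1] nonneg[of 2] 4 by (simp add: field_simps)
    ultimately have "Re y \<le> 3 / 2"
      using Re_le_of_square_quadratic Im root \<open>y \<noteq> 0\<close> by (metis mult_eq_0_iff)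
    then show ?thesis using 4 Re by simp
  qed
qed

(* The floor bounds are asserted for d \<ge> 2 only: for d = 1 they would read 0 \<le> Re \<alpha> \<le> -1,
   whereas every SSNN polynomial of degree 1 has the single root -1/2. *)
theorem theorem0p5:
  fixes d :: nat and f :: "real poly" and \<alpha> :: complex
  assumes "d \<ge> 1"
    and "SSNN_poly d f"
    and "poly (map_poly complex_of_real f) \<alpha> = 0"
  shows "(\<alpha> \<in> \<real> \<longrightarrow>
            (- (real d / 2) \<le> Re \<alpha> \<and> Re \<alpha> \<le> real d / 2 - 1) \<and>
            (d \<ge> 2 \<longrightarrow>
               - real_of_int \<lfloor>real d / 2\<rfloor> \<le> Re \<alpha> \<and>
               Re \<alpha> \<le> real_of_int \<lfloor>real d / 2\<rfloor> - 1)) \<and>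
         (d \<le> 5 \<longrightarrow>
            (- (real d / 2) \<le> Re \<alpha> \<and> Re \<alpha> \<le> real d / 2 - 1) \<and>
            (d \<ge> 2 \<longrightarrow>
               - real_of_int \<lfloor>real d / 2\<rfloor> \<le> Re \<alpha> \<and>
               Re \<alpha> \<le> real_of_int \<lfloor>real d / 2\<rfloor> - 1))"
proof -
  obtain \<delta> where \<delta>: "symmetric_nonneg_seq d \<delta>" and root: "weighted_sum d \<delta> \<alpha> = 0"
    using SSNN_poly_rootE assms(2,3) by blast
  have reflected: "weighted_sum d \<delta> (- 1 - \<alpha>) = 0"
    using weighted_sum_reflect[OF \<delta>, of \<alpha>] root by simp
  show ?thesis
  proof (cases "d = 1")
    case True
    have s: "\<delta> (Suc 0) = \<delta> 0" using symmetric_nonneg_seqD(3)[OF \<delta>, of 0] True by simp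
    have "\<delta> 0 \<noteq> 0" using sum_pos_of_symmetric_nonneg_seq[OF \<delta>] True s by auto
    have "of_real (\<delta> 0) * (2 * \<alpha> + 1) = 0"
      using root by (simp add: weighted_sum_def window_prod_def True s algebra_simps)
    then have "2 * \<alpha> + 1 = 0" using \<open>\<delta> 0 \<noteq> 0\<close> by simp
    from arg_cong[OF this, of Re] have "Re \<alpha> = - 1 / 2" by simp
    then show ?thesis using True by simp
  next
    case False
    then have d: "d \<ge> 2" using assms(1) by simp
    have "Re \<alpha> \<le> real (d div 2) - 1 \<and> - real (d div 2) \<le> Re \<alpha>" if "\<alpha> \<in> \<real> \<or> d \<le> 5"
    proof -
      \<comment> \<open>Used for \<open>\<alpha>\<close> and for \<open>- 1 - \<alpha>\<close>; the
        latter yields the lower bound.\<close>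
      have "Re \<beta> \<le> real (d div 2) - 1" if "weighted_sum d \<delta> \<beta> = 0" "\<beta> \<in> \<real> \<or> d \<le> 5" for \<beta>
        using Re_le_of_real_root Re_le_of_small_degree \<delta> d that by blast
      from this[OF root that] this[OF reflected] that show ?thesis by auto
    qed
    moreover have "real_of_int \<lfloor>real d / 2\<rfloor> = real (d div 2)"
      using floor_divide_of_nat_eq[of d 2, where ?'a = real] by simp
    moreover have "real (d div 2) \<le> real d / 2" by linarith
    ultimately show ?thesis by fastforce
  qed
qed

end
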